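(* Let $Q$ be a finite quandle and let $\rho:Q\to GL(V)$ be an irreducible representation of $Q$ over $\mathbb{C}$. Let $\theta:Q\to Inn(Q)$, $x\mapsto L_x$. 1) Let $\rho':Q\to GL(V)$ be an irreducible representation such that $\rho'_{Inn(Q)}=\rho_{Inn(Q)}$. Then $\rho'=\chi\cdot\rho$ for some character $\chi$ of $Q$. 2) Assume that $\rho_{Inn(Q)}$ lifts to a linear representation $\tilde\rho_{Inn(Q)}:Inn(Q)\to GL(V)$. Then $\tilde\rho_{Inn(Q)}\circ\theta$ is an irreducible representation of $Q$ and $\rho=\chi\cdot(\tilde\rho_{Inn(Q)}\circ\theta)$ for some character $\chi$ of $Q$.
   Context: A quandle is a set $Q$ with a binary operation $\triangleright$ such that $x\triangleright x=x$; $x\triangleright(y\triangleright z)=(x\triangleright y)\triangleright(x\triangleright z)$; and for all $x,y\in Q$ there is a unique $z\in Q$ with $x\triangleright z=y$. For $x\in Q$, $L_x:Q\to Q$ is the bijection $L_x(y)=x\triangleright y$; $Inn(Q)$ is the group of bijections of $Q$ generated by all $L_x$. A representation of $Q$ on a complex vector space $V$ is a map $\rho:Q\to GL(V)$ with $\rho(x\triangleright y)=\rho(x)\rho(y)\rho(x)^{-1}$. It is irreducible if $V\neq0$ and the only subspaces $W\subset V$ with $\rho(x)(W)\subset W$ for all $x\in Q$ are $0$ and $V$. Irreducible complex representations of a finite quandle are known to be finite dimensional. A character of $Q$ is a map $\chi:Q\to\mathbb{C}^\times$ with $\chi(x\triangleright y)=\chi(y)$ for all $x,y\in Q$; $(\chi\cdot\rho)(x)=\chi(x)\rho(x)$.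 The enveloping group is $G(Q)=\langle x\in Q\mid xyx^{-1}=x\triangleright y,\ x,y\in Q\rangle$, with $\varphi_Q:Q\to G(Q)$ sending $x$ to the corresponding generator. $\rho_{G(Q)}:G(Q)\to GL(V)$ is the unique group morphism with $\rho_{G(Q)}\circ\varphi_Q=\rho$. $\theta_{G(Q)}:G(Q)\to Inn(Q)$ is the surjective group morphism with $\theta_{G(Q)}(\varphi_Q(x))=L_x$; its kernel is known to be central in $G(Q)$. For $\rho$ irreducible, $\rho_{Inn(Q)}:Inn(Q)\to PGL(V)$ is the projective representation $\rho_{Inn(Q)}(a)=\overline{\rho_{G(Q)}(s(a))}$ for any set-theoretic section $s$ of $\theta_{G(Q)}$ (independent of $s$), where the overline is the class in $PGL(V)$; it satisfies $\rho_{Inn(Q)}(L_x)=\overline{\rho(x)}$. A lift of $\rho_{Inn(Q)}$ to a linear representation is a group morphism $Inn(Q)\to GL(V)$ whose composition with $GL(V)\to PGL(V)$ is $\rho_{Inn(Q)}$. *)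

theory Defs
  imports Complex_Main "HOL-Algebra.Bij" "HOL-Algebra.Elementary_Groups"
begin

section \<open>Quandles and their inner groups\<close>

record 'a quandle_struct = "'a partial_object" +
  tri :: "'a \<Rightarrow> 'a \<Rightarrow> 'a" (infixl \<open>\<triangleright>\<index>\<close> 70)

locale quandle =
  fixes Q :: "('a, 'm) quandle_struct_scheme" (structure)
  assumes tri_closed: "\<lbrakk>x \<in> carrier Q; y \<in> carrier Q\<rbrakk> \<Longrightarrow> x \<triangleright> y \<in> carrier Q"
    and tri_idem: "x \<in> carrier Q \<Longrightarrow> x \<triangleright> x = x"
    and tri_distrib: "\<lbrakk>x \<in> carrier Q; y \<in> carrier Q; z \<in> carrier Q\<rbrakk>
      \<Longrightarrow> x \<triangleright> (y \<triangleright> z) = (x \<triangleright> y) \<triangleright> (x \<triangleright> z)"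
    and tri_ex1: "\<lbrakk>x \<in> carrier Q; y \<in> carrier Q\<rbrakk> \<Longrightarrow> \<exists>!z. z \<in> carrier Q \<and> x \<triangleright> z = y"

text \<open>\<open>left_mult Q x\<close> is the left multiplication \<open>L\<^sub>x\<close>. It is restricted to the carrier so that it is
  an element of \<^term>\<open>BijGroup (carrier Q)\<close>, whose elements are extensional functions.\<close>

definition left_mult :: "('a, 'm) quandle_struct_scheme \<Rightarrow> 'a \<Rightarrow> 'a \<Rightarrow> 'a" where
  "left_mult Q x = (\<lambda>y\<in>carrier Q. x \<triangleright>\<^bsub>Q\<^esub> y)"

definition Inn :: "('a, 'm) quandle_struct_scheme \<Rightarrow> ('a \<Rightarrow> 'a) monoid" where
  "Inn Q = subgroup_generated (BijGroup (carrier Q)) (left_mult Q ` carrier Q)"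

lemma left_mult_Bij:
  assumes "quandle Q" "x \<in> carrier Q" shows "left_mult Q x \<in> carrier (BijGroup (carrier Q))"
proof -
  interpret quandle Q by fact
  show ?thesis
    using tri_ex1[OF assms(2)] tri_closed[OF assms(2)] assms(2)
    by (auto simp: BijGroup_def Bij_def left_mult_def bij_betw_def inj_on_def image_def) (metis+)
qed

lemma group_Inn: "group (Inn Q)"
  unfolding Inn_def by (rule group.group_subgroup_generated[OF group_BijGroup])

lemma left_mult_Inn:
  assumes "quandle Q" "x \<in> carrier Q" shows "left_mult Q x \<in> carrier (Inn Q)"
  using assms left_mult_Bij[OF assms] unfolding Inn_def carrier_subgroup_generated by (auto intro: generate.incl)

lemma left_mult_rel:
  assumes "quandle Q" "x \<in> carrier Q" "y \<in> carrier Q"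
  shows "left_mult Q (x \<triangleright>\<^bsub>Q\<^esub> y) = left_mult Q x \<otimes>\<^bsub>Inn Q\<^esub> left_mult Q y \<otimes>\<^bsub>Inn Q\<^esub> inv\<^bsub>Inn Q\<^esub> left_mult Q x"
proof -
  interpret quandle Q by fact
  interpret group "Inn Q" by (rule group_Inn)
  have xy: "x \<triangleright>\<^bsub>Q\<^esub> y \<in> carrier Q" using tri_closed assms by auto
  have m: "left_mult Q a \<otimes>\<^bsub>Inn Q\<^esub> left_mult Q b = compose (carrier Q) (left_mult Q a) (left_mult Q b)"
    if "a \<in> carrier Q" "b \<in> carrier Q" for a b
    using left_mult_Bij[OF assms(1)] that by (auto simp: Inn_def subgroup_generated_def BijGroup_def)
  have eq: "left_mult Q (x \<triangleright>\<^bsub>Q\<^esub> y) \<otimes>\<^bsub>Inn Q\<^esub> left_mult Q x = left_mult Q x \<otimes>\<^bsub>Inn Q\<^esub> left_mult Q y"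
    unfolding m[OF xy assms(2)] m[OF assms(2,3)] compose_def
  proof (rule restrict_ext)
    fix z assume "z \<in> carrier Q"
    then show "left_mult Q (x \<triangleright>\<^bsub>Q\<^esub> y) (left_mult Q x z) = left_mult Q x (left_mult Q y z)"
      using assms tri_distrib[of x y z] by (simp add: left_mult_def tri_closed)
  qed
  note L = left_mult_Inn[OF assms(1)]
  show ?thesis
    unfolding eq[symmetric] using L[OF xy] L[OF assms(2)] by (simp add: m_assoc)
qed


section \<open>The enveloping group\<close>

text \<open>The group presented by generators \<open>x \<in> Q\<close> and relations \<open>x y x\<^sup>-\<^sup>1 = x \<triangleright> y\<close> is realised as words
  modulo the congruence generated by free cancellation and these relations. The letter
  \<open>(x, True)\<close> stands for the generator \<open>x\<close> and \<open>(x, False)\<close> for its formal inverse.\<close>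

definition env_words :: "('a, 'm) quandle_struct_scheme \<Rightarrow> ('a \<times> bool) list set" where
  "env_words Q = lists (carrier Q \<times> UNIV)"

inductive env_step :: "('a, 'm) quandle_struct_scheme \<Rightarrow> ('a \<times> bool) list \<Rightarrow> ('a \<times> bool) list \<Rightarrow> bool"
  for Q (structure) where
  cancel: "\<lbrakk>u \<in> env_words Q; v \<in> env_words Q; x \<in> carrier Q\<rbrakk>
    \<Longrightarrow> env_step Q (u @ [(x, e), (x, \<not> e)] @ v) (u @ v)"
| relation: "\<lbrakk>u \<in> env_words Q; v \<in> env_words Q; x \<in> carrier Q; y \<in> carrier Q\<rbrakk>
    \<Longrightarrow> env_step Q (u @ [(x, True), (y, True), (x, False)] @ v) (u @ [(x \<triangleright> y, True)] @ v)"

definition env_rel :: "('a, 'm) quandle_struct_scheme \<Rightarrow> (('a \<times> bool) list \<times> ('a \<times> bool) list) set" where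
  "env_rel Q = {(u, v). u \<in> env_words Q \<and> v \<in> env_words Q \<and> equivclp (env_step Q) u v}"

definition env_group :: "('a, 'm) quandle_struct_scheme \<Rightarrow> ('a \<times> bool) list set monoid" where
  "env_group Q =
    \<lparr>carrier = env_words Q // env_rel Q,
     mult = \<lambda>A B. \<Union>u\<in>A. \<Union>v\<in>B. env_rel Q `` {u @ v},
     one = env_rel Q `` {[]}\<rparr>"

definition env_gen :: "('a, 'm) quandle_struct_scheme \<Rightarrow> 'a \<Rightarrow> ('a \<times> bool) list set" where
  "env_gen Q x = env_rel Q `` {[(x, True)]}"

lemma env_words_simps [simp]:
  "[] \<in> env_words Q"
  "p # u \<in> env_words Q \<longleftrightarrow> fst p \<in> carrier Q \<and> u \<in> env_words Q"
  "u @ v \<in> env_words Q \<longleftrightarrow> u \<in> env_words Q \<and> v \<in> env_words Q"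
  by (auto simp: env_words_def mem_Times_iff)

lemma equiv_env_rel: "equiv (env_words Q) (env_rel Q)"
  by (rule equivI)
    (auto simp: env_rel_def refl_on_def sym_def trans_def intro: equivclp_sym equivclp_trans)

lemma env_step_append: "env_step Q u v \<Longrightarrow> a \<in> env_words Q \<Longrightarrow> b \<in> env_words Q \<Longrightarrow> env_step Q (a @ u @ b) (a @ v @ b)"
proof (induction rule: env_step.induct)
  case (cancel u v x e)
  then show ?case using env_step.cancel[of "a @ u" Q "v @ b" x e] by simp
next
  case (relation u v x y)
  then show ?case using env_step.relation[of "a @ u" Q "v @ b" x y] by simp
qed

lemma equivclp_env_append:
  assumes "equivclp (env_step Q) u v" "a \<in> env_words Q" "b \<in> env_words Q"
  shows "equivclp (env_step Q) (a @ u @ b) (a @ v @ b)"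
  using assms(1)
proof (induction rule: equivclp_induct)
  case base
  then show ?case by simp
next
  case (step y z)
  have "equivclp (env_step Q) (a @ y @ b) (a @ z @ b)"
    using step(2) env_step_append[OF _ assms(2,3)] by (meson equivclp_sym r_into_equivclp)
  with step.IH show ?case by (rule equivclp_trans)
qed

lemma env_rel_append:
  assumes "(u, u') \<in> env_rel Q" "(v, v') \<in> env_rel Q"
  shows "(u @ v, u' @ v') \<in> env_rel Q"
proof -
  have "equivclp (env_step Q) (u @ v) (u' @ v)"
    using assms equivclp_env_append[of Q u u' "[]" v] by (auto simp: env_rel_def)
  moreover have "equivclp (env_step Q) (u' @ v) (u' @ v')"
    using assms equivclp_env_append[of Q v v' u' "[]"] by (auto simp: env_rel_def)
  ultimately show ?thesis using assms by (auto simp: env_rel_def intro: equivclp_trans)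
qed

lemma env_mult_class:
  assumes "u \<in> env_words Q" "v \<in> env_words Q"
  shows "env_rel Q `` {u} \<otimes>\<^bsub>env_group Q\<^esub> env_rel Q `` {v} = env_rel Q `` {u @ v}"
proof -
  have *: "env_rel Q `` {a @ b} = env_rel Q `` {u @ v}"
    if "(u, a) \<in> env_rel Q" "(v, b) \<in> env_rel Q" for a b
    using env_rel_append[OF that] equiv_class_eq[OF equiv_env_rel] by metis
  have "(u,u) \<in> env_rel Q" "(v,v) \<in> env_rel Q" using assms by (auto simp: env_rel_def)
  then have "u \<in> env_rel Q `` {u}" "v \<in> env_rel Q `` {v}" by blast+
  moreover have "env_rel Q `` {a @ b} = env_rel Q `` {u @ v}"
    if "a \<in> env_rel Q `` {u}" "b \<in> env_rel Q `` {v}" for a b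
    using that by (intro *) blast+
  ultimately have "(\<Union>a\<in>env_rel Q `` {u}. \<Union>b\<in>env_rel Q `` {v}. env_rel Q `` {a @ b}) = env_rel Q `` {u @ v}"
    by blast
  then show ?thesis by (simp add: env_group_def)
qed

lemma env_carrier: "carrier (env_group Q) = {env_rel Q `` {u} |u. u \<in> env_words Q}"
  by (auto simp: env_group_def quotient_def)

lemma env_one: "\<one>\<^bsub>env_group Q\<^esub> = env_rel Q `` {[]}" by (simp add: env_group_def)

lemma env_inv_word: "u \<in> env_words Q \<Longrightarrow> \<exists>v\<in>env_words Q. equivclp (env_step Q) (v @ u) []"
proof (induction u)
  case Nil
  then show ?case by (intro bexI[of _ "[]"]) auto
next
  case (Cons p u)
  then obtain v where v: "v \<in> env_words Q" "equivclp (env_step Q) (v @ u) []" by auto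
  obtain x e where p: "p = (x, e)" by force
  have "env_step Q (v @ [(x, \<not> e), (x, \<not>\<not> e)] @ u) (v @ u)"
    using Cons.prems v p by (intro env_step.cancel) auto
  with v Cons.prems p show ?case
    by (intro bexI[of _ "v @ [(x, \<not> e)]"]) (auto intro: equivclp_trans r_into_equivclp)
qed

lemma group_env_group: "group (env_group Q)"
proof (rule groupI)
  fix A assume "A \<in> carrier (env_group Q)"
  then obtain u where u: "u \<in> env_words Q" "A = env_rel Q `` {u}" by (auto simp: env_carrier)
  then obtain v where v: "v \<in> env_words Q" "equivclp (env_step Q) (v @ u) []" using env_inv_word by blast
  then have "(v @ u, []) \<in> env_rel Q" using u by (auto simp: env_rel_def)
  then have "env_rel Q `` {v @ u} = env_rel Q `` {[]}" using equiv_class_eq[OF equiv_env_rel] by blast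
  with u v show "\<exists>B\<in>carrier (env_group Q). B \<otimes>\<^bsub>env_group Q\<^esub> A = \<one>\<^bsub>env_group Q\<^esub>"
    by (intro bexI[of _ "env_rel Q `` {v}"]) (auto simp: env_mult_class env_one env_carrier)
  show "\<one>\<^bsub>env_group Q\<^esub> \<otimes>\<^bsub>env_group Q\<^esub> A = A" using u by (auto simp: env_mult_class env_one)
next
  show "\<one>\<^bsub>env_group Q\<^esub> \<in> carrier (env_group Q)" by (auto simp: env_one env_carrier intro!: exI[of _ "[]"])
next
  fix A B assume "A \<in> carrier (env_group Q)" "B \<in> carrier (env_group Q)"
  then obtain u v where "u \<in> env_words Q" "v \<in> env_words Q" "A = env_rel Q `` {u}" "B = env_rel Q `` {v}"
    by (auto simp: env_carrier)
  then show "A \<otimes>\<^bsub>env_group Q\<^esub> B \<in> carrier (env_group Q)"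
    by (auto simp: env_carrier env_mult_class intro!: exI[of _ "u @ v"])
qed (auto simp: env_carrier env_mult_class)

fun env_eval :: "('g, 'n) monoid_scheme \<Rightarrow> ('a \<Rightarrow> 'g) \<Rightarrow> ('a \<times> bool) list \<Rightarrow> 'g" where
  "env_eval H f [] = \<one>\<^bsub>H\<^esub>"
| "env_eval H f ((x, e) # u) = (if e then f x else inv\<^bsub>H\<^esub> f x) \<otimes>\<^bsub>H\<^esub> env_eval H f u"

lemma env_eval_closed:
  assumes "group H" "f \<in> carrier Q \<rightarrow> carrier H"
  shows "u \<in> env_words Q \<Longrightarrow> env_eval H f u \<in> carrier H"
proof (induction u)
  case (Cons p u)
  interpret group H by fact
  from Cons show ?case using assms(2) by (cases p) auto
qed (use assms in \<open>auto simp: group.is_monoid\<close>)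

lemma env_eval_append:
  assumes "group H" "f \<in> carrier Q \<rightarrow> carrier H"
  shows "u \<in> env_words Q \<Longrightarrow> v \<in> env_words Q \<Longrightarrow> env_eval H f (u @ v) = env_eval H f u \<otimes>\<^bsub>H\<^esub> env_eval H f v"
proof (induction u)
  case Nil
  interpret group H by fact
  from Nil show ?case using env_eval_closed[OF assms] by simp
next
  case (Cons p u)
  interpret group H by fact
  have "fst p \<in> carrier Q" using Cons by auto
  then have "f (fst p) \<in> carrier H" using assms(2) by auto
  with Cons show ?case using env_eval_closed[OF assms] by (cases p) (auto simp: m_assoc)
qed

text \<open>The universal property of the presented group; it makes the definite description in
  \<open>env_lift\<close> below well-defined.\<close>

lemma env_lift_ex1:
  assumes "quandle Q" "group H" "f \<in> carrier Q \<rightarrow> carrier H"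
    and rel: "\<And>x y. x \<in> carrier Q \<Longrightarrow> y \<in> carrier Q \<Longrightarrow> f (x \<triangleright>\<^bsub>Q\<^esub> y) = f x \<otimes>\<^bsub>H\<^esub> f y \<otimes>\<^bsub>H\<^esub> inv\<^bsub>H\<^esub> f x"
  shows "\<exists>!h. h \<in> hom (env_group Q) H \<and> h \<in> extensional (carrier (env_group Q)) \<and>
    (\<forall>x\<in>carrier Q. h (env_gen Q x) = f x)"
proof -
  interpret group H by fact
  interpret quandle Q by fact
  note cl = env_eval_closed[OF assms(2,3)] and ap = env_eval_append[OF assms(2,3)]
  have fcl: "f x \<in> carrier H" if "x \<in> carrier Q" for x using that assms(3) by auto
  have step: "env_eval H f u = env_eval H f v" if "env_step Q u v" for u v
    using that
  proof cases
    case (cancel u v x e)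
    then show ?thesis using fcl[of x] cl[of u] cl[of v] by (cases e) (auto simp: ap m_assoc[symmetric])
  next
    case (relation u v x y)
    then show ?thesis using fcl[of x] fcl[of y] cl[of u] cl[of v] by (auto simp: ap m_assoc rel tri_closed)
  qed
  have eq: "env_eval H f u = env_eval H f v" if "(u, v) \<in> env_rel Q" for u v
  proof -
    have "equivclp (env_step Q) u v" using that by (auto simp: env_rel_def)
    then show ?thesis
      by (induction rule: equivclp_induct) (auto dest: step)
  qed
  define h where "h = (\<lambda>A\<in>carrier (env_group Q). env_eval H f (SOME u. u \<in> A))"
  have hcl: "h (env_rel Q `` {u}) = env_eval H f u" if "u \<in> env_words Q" for u
  proof -
    have "u \<in> env_rel Q `` {u}" using that by (auto simp: env_rel_def)
    then have "(SOME w. w \<in> env_rel Q `` {u}) \<in> env_rel Q `` {u}" by (rule someI)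
    then have "env_eval H f (SOME w. w \<in> env_rel Q `` {u}) = env_eval H f u" using eq by auto
    with that show ?thesis unfolding h_def by (auto simp: env_carrier)
  qed
  show ?thesis
  proof (rule ex1I[of _ h], intro conjI ballI)
    show "h \<in> hom (env_group Q) H"
      by (rule homI) (auto simp: env_carrier hcl cl env_mult_class ap)
    show "h \<in> extensional (carrier (env_group Q))" by (auto simp: h_def)
    fix x assume x: "x \<in> carrier Q"
    then show "h (env_gen Q x) = f x" using fcl by (auto simp: env_gen_def hcl)
  next
    fix k assume k: "k \<in> hom (env_group Q) H \<and> k \<in> extensional (carrier (env_group Q)) \<and> (\<forall>x\<in>carrier Q. k (env_gen Q x) = f x)"
    interpret k: group_hom "env_group Q" H k
      using k group_env_group assms(2) by (auto simp: group_hom_def group_hom_axioms_def)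
    have letter: "k (env_rel Q `` {[(x, e)]}) = (if e then f x else inv\<^bsub>H\<^esub> f x)" if x: "x \<in> carrier Q" for x e
    proof (cases e)
      case False
      have "env_step Q ([] @ [(x, False), (x, \<not> False)] @ []) ([] @ [])"
        by (rule env_step.cancel) (use x in auto)
      then have "([(x, False), (x, True)], []) \<in> env_rel Q" using x by (auto simp: env_rel_def)
      then have "env_rel Q `` {[(x, False), (x, True)]} = env_rel Q `` {[]}"
        using equiv_class_eq[OF equiv_env_rel] by blast
      then have "env_rel Q `` {[(x, False)]} \<otimes>\<^bsub>env_group Q\<^esub> env_rel Q `` {[(x, True)]} = \<one>\<^bsub>env_group Q\<^esub>"
        using x by (auto simp: env_mult_class env_one)
      moreover have c: "env_rel Q `` {[(x, e)]} \<in> carrier (env_group Q)" for e using x by (auto simp: env_carrier)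
      ultimately have "k (env_rel Q `` {[(x, False)]}) \<otimes>\<^bsub>H\<^esub> f x = \<one>\<^bsub>H\<^esub>"
        using k x by (metis env_gen_def k.hom_mult k.hom_one)
      with False show ?thesis using c fcl[OF x] by (metis inv_equality k.hom_closed)
    qed (use k x in \<open>auto simp: env_gen_def\<close>)
    have "k (env_rel Q `` {u}) = env_eval H f u" if "u \<in> env_words Q" for u
      using that
    proof (induction u)
      case Nil
      then show ?case using k.hom_one by (simp add: env_one)
    next
      case (Cons p u)
      obtain x e where p: "p = (x, e)" by force
      have "env_rel Q `` {p # u} = env_rel Q `` {[p]} \<otimes>\<^bsub>env_group Q\<^esub> env_rel Q `` {u}"
        using Cons env_mult_class[of "[p]" Q u] by auto
      moreover have "env_rel Q `` {[p]} \<in> carrier (env_group Q)" "env_rel Q `` {u} \<in> carrier (env_group Q)"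
        using Cons by (auto simp: env_carrier)
      ultimately show ?case using Cons letter[of x e] p by simp
    qed
    then have "k A = h A" if "A \<in> carrier (env_group Q)" for A
      using that by (auto simp: env_carrier hcl)
    moreover have "h \<in> extensional (carrier (env_group Q))" by (simp add: h_def)
    ultimately show "k = h" using k by (meson extensionalityI)
  qed
qed

text \<open>The unique group morphism \<open>h\<close> from the enveloping group to \<open>H\<close> with \<open>h \<circ> \<phi>\<^sub>Q = f\<close>;
  extensionality fixes the junk values outside the carrier, so that uniqueness holds for \<open>h\<close> as
  a HOL function.\<close>

definition env_lift ::
  "('a, 'm) quandle_struct_scheme \<Rightarrow> ('g, 'n) monoid_scheme \<Rightarrow> ('a \<Rightarrow> 'g) \<Rightarrow> ('a \<times> bool) list set \<Rightarrow> 'g" where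
  "env_lift Q H f = (THE h. h \<in> hom (env_group Q) H \<and> h \<in> extensional (carrier (env_group Q)) \<and>
    (\<forall>x\<in>carrier Q. h (env_gen Q x) = f x))"

abbreviation theta_env :: "('a, 'm) quandle_struct_scheme \<Rightarrow> ('a \<times> bool) list set \<Rightarrow> 'a \<Rightarrow> 'a" where
  "theta_env Q \<equiv> env_lift Q (Inn Q) (left_mult Q)"


section \<open>Linear and projective groups of a complex vector space\<close>

text \<open>A complex vector space, of arbitrary dimension, is a type \<open>'v\<close> with a scalar multiplication
  satisfying \<^term>\<open>vector_space scale\<close>.\<close>

definition GL :: "(complex \<Rightarrow> 'v \<Rightarrow> 'v) \<Rightarrow> ('v::ab_group_add \<Rightarrow> 'v) monoid" where
  "GL scale = \<lparr>carrier = {f. Vector_Spaces.linear scale scale f \<and> bij f}, mult = (\<circ>), one = id\<rparr>"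

lemma group_GL:
  assumes "vector_space scale" shows "group (GL scale)"
proof -
  interpret vector_space scale by fact
  interpret vector_space_pair scale scale by unfold_locales
  show ?thesis
  proof (rule groupI)
    fix f assume "f \<in> carrier (GL scale)"
    then have f: "Vector_Spaces.linear scale scale f" "bij f" by (auto simp: GL_def)
    interpret f: Vector_Spaces.linear scale scale f by fact
    have "Vector_Spaces.linear scale scale (inv_into UNIV f)"
    proof -
      have i: "inv_into UNIV f (f x) = x" "f (inv_into UNIV f x) = x" for x
        using f(2) by (simp_all add: bij_is_inj bij_is_surj surj_f_inv_f)
      show ?thesis
        by unfold_locales (metis f.add i, metis f.scale i)
    qed
    then show "\<exists>g\<in>carrier (GL scale). g \<otimes>\<^bsub>GL scale\<^esub> f = \<one>\<^bsub>GL scale\<^esub>"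
      using f by (intro bexI[of _ "inv_into UNIV f"]) (auto simp: GL_def bij_imp_bij_inv bij_is_inj)
  next
    fix f g assume "f \<in> carrier (GL scale)" "g \<in> carrier (GL scale)"
    then show "f \<otimes>\<^bsub>GL scale\<^esub> g \<in> carrier (GL scale)"
      using Vector_Spaces.linear_compose[of scale scale g scale f] by (simp add: GL_def bij_comp)
  next
    show "\<one>\<^bsub>GL scale\<^esub> \<in> carrier (GL scale)" by (simp add: GL_def linear_id)
  qed (simp_all add: GL_def o_assoc)
qed

definition homotheties :: "(complex \<Rightarrow> 'v \<Rightarrow> 'v) \<Rightarrow> ('v::ab_group_add \<Rightarrow> 'v) set" where
  "homotheties scale = {scale c | c. c \<noteq> 0}"

definition PGL :: "(complex \<Rightarrow> 'v \<Rightarrow> 'v) \<Rightarrow> ('v::ab_group_add \<Rightarrow> 'v) set monoid" where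
  "PGL scale = GL scale Mod homotheties scale"

text \<open>The class of \<open>f\<close> in \<^term>\<open>PGL scale\<close>, i.e. the quotient map from \<^term>\<open>GL scale\<close>.\<close>

definition proj_class :: "(complex \<Rightarrow> 'v \<Rightarrow> 'v) \<Rightarrow> ('v::ab_group_add \<Rightarrow> 'v) \<Rightarrow> ('v \<Rightarrow> 'v) set" where
  "proj_class scale f = homotheties scale #>\<^bsub>GL scale\<^esub> f"


section \<open>Representations and characters of quandles\<close>

definition quandle_rep ::
  "('a, 'm) quandle_struct_scheme \<Rightarrow> (complex \<Rightarrow> 'v \<Rightarrow> 'v) \<Rightarrow> ('a \<Rightarrow> 'v::ab_group_add \<Rightarrow> 'v) \<Rightarrow> bool" where
  "quandle_rep Q scale \<rho> \<longleftrightarrow> \<rho> \<in> carrier Q \<rightarrow> carrier (GL scale) \<and>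
    (\<forall>x\<in>carrier Q. \<forall>y\<in>carrier Q.
      \<rho> (x \<triangleright>\<^bsub>Q\<^esub> y) = \<rho> x \<otimes>\<^bsub>GL scale\<^esub> \<rho> y \<otimes>\<^bsub>GL scale\<^esub> inv\<^bsub>GL scale\<^esub> \<rho> x)"

definition irreducible_quandle_rep ::
  "('a, 'm) quandle_struct_scheme \<Rightarrow> (complex \<Rightarrow> 'v \<Rightarrow> 'v) \<Rightarrow> ('a \<Rightarrow> 'v::ab_group_add \<Rightarrow> 'v) \<Rightarrow> bool" where
  "irreducible_quandle_rep Q scale \<rho> \<longleftrightarrow> quandle_rep Q scale \<rho> \<and> (UNIV :: 'v set) \<noteq> {0} \<and>
    (\<forall>W. module.subspace scale W \<and> (\<forall>x\<in>carrier Q. \<rho> x ` W \<subseteq> W) \<longrightarrow> W = {0} \<or> W = UNIV)"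

definition quandle_character :: "('a, 'm) quandle_struct_scheme \<Rightarrow> ('a \<Rightarrow> complex) \<Rightarrow> bool" where
  "quandle_character Q \<chi> \<longleftrightarrow> \<chi> \<in> carrier Q \<rightarrow> UNIV - {0} \<and>
    (\<forall>x\<in>carrier Q. \<forall>y\<in>carrier Q. \<chi> (x \<triangleright>\<^bsub>Q\<^esub> y) = \<chi> y)"

definition char_twist ::
  "(complex \<Rightarrow> 'v \<Rightarrow> 'v) \<Rightarrow> ('a \<Rightarrow> complex) \<Rightarrow> ('a \<Rightarrow> 'v \<Rightarrow> 'v) \<Rightarrow> 'a \<Rightarrow> 'v \<Rightarrow> 'v" where
  "char_twist scale \<chi> \<rho> x = (\<lambda>v. scale (\<chi> x) (\<rho> x v))"


section \<open>The projective representation of the inner group\<close>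

abbreviation rep_env ::
  "('a, 'm) quandle_struct_scheme \<Rightarrow> (complex \<Rightarrow> 'v \<Rightarrow> 'v) \<Rightarrow> ('a \<Rightarrow> 'v \<Rightarrow> 'v)
    \<Rightarrow> ('a \<times> bool) list set \<Rightarrow> 'v::ab_group_add \<Rightarrow> 'v" where
  "rep_env Q scale \<rho> \<equiv> env_lift Q (GL scale) \<rho>"

text \<open>The section of the surjection \<^term>\<open>theta_env Q\<close> is chosen by \<^const>\<open>inv_into\<close>. For irreducible \<open>\<rho>\<close>
  the class does not depend on this choice, since the kernel of \<^term>\<open>theta_env Q\<close> is central and so
  acts by scalars.\<close>

definition rep_Inn ::
  "('a, 'm) quandle_struct_scheme \<Rightarrow> (complex \<Rightarrow> 'v \<Rightarrow> 'v) \<Rightarrow> ('a \<Rightarrow> 'v \<Rightarrow> 'v)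
    \<Rightarrow> ('a \<Rightarrow> 'a) \<Rightarrow> ('v::ab_group_add \<Rightarrow> 'v) set" where
  "rep_Inn Q scale \<rho> = (\<lambda>a\<in>carrier (Inn Q).
    proj_class scale (rep_env Q scale \<rho> (inv_into (carrier (env_group Q)) (theta_env Q) a)))"

definition lifts_rep_Inn ::
  "('a, 'm) quandle_struct_scheme \<Rightarrow> (complex \<Rightarrow> 'v \<Rightarrow> 'v) \<Rightarrow> ('a \<Rightarrow> 'v \<Rightarrow> 'v)
    \<Rightarrow> (('a \<Rightarrow> 'a) \<Rightarrow> 'v::ab_group_add \<Rightarrow> 'v) \<Rightarrow> bool" where
  "lifts_rep_Inn Q scale \<rho> \<sigma> \<longleftrightarrow> \<sigma> \<in> hom (Inn Q) (GL scale) \<and>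
    (\<forall>a\<in>carrier (Inn Q). proj_class scale (\<sigma> a) = rep_Inn Q scale \<rho> a)"

end

theory Submission
  imports Defs
    "HOL-Computational_Algebra.Fundamental_Theorem_Algebra"
    "HOL-Analysis.Continuum_Not_Denumerable"
begin

text \<open>The projective representation of \<open>Inn(Q)\<close> determines an irreducible \<open>\<rho>\<close> up to a scalar at each
  point, because \<open>\<rho>\<^sub>I\<^sub>n\<^sub>n(L\<^sub>x)\<close> is the class of \<open>\<rho>(x)\<close> (\<open>rep_Inn_left_mult\<close>). Indeed, let \<open>s\<close> be any
  element of the enveloping group lying over \<open>L\<^sub>x\<close>, and let \<open>R\<close> be its image in \<open>GL(V)\<close>. Then
  \<open>R \<rho>(y) = \<rho>(x \<triangleright> y) R\<close> (\<open>env_lift_twisted_commute\<close>), and \<open>\<rho>(x)\<close> satisfies the same relation; so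
  \<open>R\<^sup>-\<^sup>1 \<rho>(x)\<close> commutes with every \<open>\<rho>(y)\<close>, and Schur's lemma makes it a homothety.

  No dimension is assumed for \<open>V\<close>, and finite dimensionality is not needed: Schur's lemma over
  \<open>\<complex>\<close> holds for any irreducible countable set of operators (\<open>schur_countable\<close>). This is Dixmier's
  argument. An irreducible space has a countable spanning set. If a commuting operator \<open>T\<close> had no
  eigenvalue, then every \<open>T - c\<close> would be invertible and the vectors \<open>(T - c)\<^sup>-\<^sup>1 v\<close>, with \<open>c\<close> in \<open>\<complex>\<close>,
  would form an uncountable independent family. So \<open>T\<close> has an eigenvalue, whose eigenspace is invariant
  and hence everything.

  Finally, suppose that two representations are proportional at each point, \<open>\<rho>'(x) = \<chi>(x) \<rho>(x)\<close>.
  Comparing \<open>\<rho>(x \<triangleright> y) \<rho>(x) = \<rho>(x) \<rho>(y)\<close> with the same identity for \<open>\<rho>'\<close> at a vector shows that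
  \<open>\<chi>\<close> is a character (\<open>quandle_rep_proportional\<close>). Both parts are instances. In the second one,
  \<open>\<sigma>(L\<^sub>x)\<close> is a multiple of \<open>\<rho>(x)\<close>, and proportional families have the same invariant
  subspaces.\<close>

section \<open>Polynomials in a linear operator\<close>

text \<open>The value at \<open>v\<close> of the operator \<open>p(T)\<close>, computed by Horner's scheme.\<close>

definition poly_act :: "('k::field \<Rightarrow> 'v \<Rightarrow> 'v) \<Rightarrow> ('v::ab_group_add \<Rightarrow> 'v) \<Rightarrow> 'k poly \<Rightarrow> 'v \<Rightarrow> 'v" where
  "poly_act scale T p v = fold_coeffs (\<lambda>a w. scale a v + T w) p 0"

context
  fixes scale :: "'k::field \<Rightarrow> 'v::ab_group_add \<Rightarrow> 'v" and T :: "'v \<Rightarrow> 'v"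
  assumes lin: "Vector_Spaces.linear scale scale T"
begin

interpretation T: Vector_Spaces.linear scale scale T by (rule lin)

lemma poly_act_0 [simp]: "poly_act scale T 0 v = 0"
  by (simp add: poly_act_def)

lemma poly_act_pCons [simp]: "poly_act scale T (pCons a p) v = scale a v + T (poly_act scale T p v)"
  by (cases "a = 0 \<and> p = 0") (auto simp: poly_act_def T.zero)

lemma poly_act_add: "poly_act scale T (p + q) v = poly_act scale T p v + poly_act scale T q v"
  by (induction p q rule: poly_induct2) (simp_all add: T.add T.vs1.scale_left_distrib)

lemma poly_act_smult: "poly_act scale T (smult a p) v = scale a (poly_act scale T p v)"
  by (induction p) (simp_all add: T.scale T.vs1.scale_right_distrib)

lemma poly_act_mult: "poly_act scale T (p * q) v = poly_act scale T p (poly_act scale T q v)"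
  by (induction p) (simp_all add: poly_act_add poly_act_smult)

lemma poly_act_sum: "poly_act scale T (sum p S) v = (\<Sum>i\<in>S. poly_act scale T (p i) v)"
  by (induction S rule: infinite_finite_induct) (simp_all add: poly_act_add)

lemma linear_poly_act: "Vector_Spaces.linear scale scale (poly_act scale T p)"
proof -
  have "poly_act scale T p (v + w) = poly_act scale T p v + poly_act scale T p w" for v w
    by (induction p) (simp_all add: T.add T.vs1.scale_right_distrib)
  moreover have "poly_act scale T p (scale a v) = scale a (poly_act scale T p v)" for a v
    by (induction p) (simp_all add: T.scale T.vs1.scale_right_distrib mult.commute)
  ultimately show ?thesis by unfold_locales
qed

end

section \<open>Schur's lemma for countable sets of operators\<close>

text \<open>Over \<open>\<complex>\<close> the operator \<open>p(T)\<close> splits into factors \<open>T - c\<close>; applied to \<open>v\<close> one after another they end at \<open>0\<close>,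
  so one of them kills a nonzero vector.\<close>

lemma eigenvector_if_annihilated:
  fixes scale :: "complex \<Rightarrow> 'v::ab_group_add \<Rightarrow> 'v"
  assumes lin: "Vector_Spaces.linear scale scale T"
    and "p \<noteq> 0" "v \<noteq> 0" "poly_act scale T p v = 0"
  shows "\<exists>c u. u \<noteq> 0 \<and> T u = scale c u"
  using assms(2,4)
proof (induction "degree p" arbitrary: p rule: less_induct)
  case less
  interpret T: Vector_Spaces.linear scale scale T by (rule lin)
  show ?case
  proof (cases "degree p = 0")
    case True
    then obtain a where "p = [:a:]" by (rule degree_eq_zeroE)
    with less.prems assms(3) show ?thesis by (simp add: poly_act_pCons[OF lin] poly_act_0[OF lin] T.zero)
  next
    case False
    then have "\<not> constant (poly p)" by (simp add: constant_degree)
    then obtain c where "poly p c = 0" using fundamental_theorem_of_algebra by blast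
    then obtain q where q: "p = [:- c, 1:] * q" by (auto simp: poly_eq_0_iff_dvd)
    let ?u = "poly_act scale T q v"
    have "poly_act scale T [:- c, 1:] ?u = 0"
      using less.prems(2) unfolding q poly_act_mult[OF lin] .
    then have "T ?u = scale c ?u"
      by (simp add: poly_act_pCons[OF lin] poly_act_0[OF lin] T.zero)
    moreover have "q \<noteq> 0" using less.prems(1) q by auto
    moreover from this have "degree q < degree p" unfolding q by (subst degree_mult_eq) auto
    ultimately show ?thesis using less.hyps[of q] by (cases "?u = 0") blast+
  qed
qed

text \<open>If \<open>T\<close> has no eigenvalue, the solutions \<open>w c\<close> of \<open>(T - c) (w c) = v\<close> are linearly independent:
  clearing denominators by \<open>\<Prod>\<^bsub>c \<in> S\<^esub> (T - c)\<close> turns a dependence among them into a polynomial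
  in \<open>T\<close> that annihilates \<open>v\<close>.\<close>

lemma independent_resolvents:
  fixes scale :: "complex \<Rightarrow> 'v::ab_group_add \<Rightarrow> 'v"
  assumes lin: "Vector_Spaces.linear scale scale T"
    and no_ev: "\<And>c u. T u = scale c u \<Longrightarrow> u = 0"
    and "v \<noteq> 0" and w: "\<And>c. T (w c) - scale c (w c) = v"
    and "finite S" and dep: "(\<Sum>c\<in>S. scale (a c) (w c)) = 0" and d: "d \<in> S"
  shows "a d = 0"
proof (rule ccontr)
  assume "a d \<noteq> 0"
  interpret T: Vector_Spaces.linear scale scale T by (rule lin)
  define P where "P = (\<lambda>A. \<Prod>c\<in>A. [:- c, 1::complex:])"
  interpret P: Vector_Spaces.linear scale scale "poly_act scale T (P S)" by (rule linear_poly_act[OF lin])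
  define p where "p = (\<Sum>c\<in>S. smult (a c) (P (S - {c})))"
  have "poly_act scale T (P (S - {c})) v = poly_act scale T (P S) (w c)" if "c \<in> S" for c
  proof -
    have "P S = P (S - {c}) * [:- c, 1:]"
      unfolding P_def using that \<open>finite S\<close> by (subst prod.remove[of _ c]) (auto simp: mult.commute)
    moreover have "poly_act scale T [:- c, 1:] (w c) = v"
      using w[of c] by (simp add: poly_act_pCons[OF lin] poly_act_0[OF lin] T.zero)
    ultimately show ?thesis by (simp only: poly_act_mult[OF lin])
  qed
  then have "poly_act scale T p v = poly_act scale T (P S) (\<Sum>c\<in>S. scale (a c) (w c))"
    by (simp add: p_def poly_act_sum[OF lin] poly_act_smult[OF lin] P.sum P.scale)
  then have "poly_act scale T p v = 0" using dep P.zero by simp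
  \<comment> \<open>At \<open>d\<close> only the summand with index \<open>d\<close> survives, and it does not vanish.\<close>
  moreover have "p \<noteq> 0"
  proof
    assume "p = 0"
    then have "poly p d = 0" by simp
    then have "0 = (\<Sum>c\<in>S. a c * poly (P (S - {c})) d)" by (simp add: p_def poly_sum)
    also have "\<dots> = a d * poly (P (S - {d})) d"
      using \<open>finite S\<close> d by (subst sum.remove[of _ d]) (auto simp: P_def poly_prod prod_zero_iff intro!: sum.neutral)
    also have "\<dots> \<noteq> 0" using \<open>a d \<noteq> 0\<close> \<open>finite S\<close> by (auto simp: P_def poly_prod prod_zero_iff)
    finally show False by simp
  qed
  ultimately obtain c u where u: "u \<noteq> 0" "T u = scale c u"
    using eigenvector_if_annihilated[OF lin _ \<open>v \<noteq> 0\<close>] by metis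
  show False using no_ev[OF u(2)] u(1) by (rule notE[rotated])
qed

text \<open>In a space with a countable spanning set \<open>B\<close>, such a family cannot be independent: uncountably
  many \<open>c\<close> would be distributed over the countably many finite subsets \<open>F\<close> of \<open>B\<close>, according to
  \<open>w c \<in> span F\<close>, while each \<open>span F\<close> contains only finitely many independent vectors.\<close>

lemma eigenvector_if_resolvents:
  fixes scale :: "complex \<Rightarrow> 'v::ab_group_add \<Rightarrow> 'v"
  assumes lin: "Vector_Spaces.linear scale scale T"
    and "countable B" and span: "module.span scale B = UNIV"
    and "v \<noteq> 0" and w: "\<And>c. T (w c) - scale c (w c) = v"
  shows "\<exists>c u. u \<noteq> 0 \<and> T u = scale c u"
proof (rule ccontr)
  assume "\<not> ?thesis"
  then have no_ev: "u = 0" if "T u = scale c u" for c u using that by blast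
  interpret T: Vector_Spaces.linear scale scale T by (rule lin)
  have indep: "a d = 0" if "finite S" "(\<Sum>c\<in>S. scale (a c) (w c)) = 0" "d \<in> S" for S a d
    by (rule independent_resolvents[OF lin _ \<open>v \<noteq> 0\<close> w that]) (rule no_ev)
  have "inj w"
  proof (rule injI)
    fix c d assume eq: "w c = w d"
    have "T (w c) - scale c (w c) = T (w c) - scale d (w c)" using w[of c] w[of d] unfolding eq by simp
    then have "scale c (w c) = scale d (w c)" by (rule diff_left_imp_eq)
    moreover have "w c \<noteq> 0" using w[of c] \<open>v \<noteq> 0\<close> by (auto simp: T.zero)
    ultimately show "c = d" by simp
  qed
  have ind: "T.vs1.independent (w ` A)" for A
    unfolding T.vs1.dependent_explicit
  proof (intro notI, elim exE conjE bexE)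
    fix S u x assume *: "finite S" "S \<subseteq> w ` A" "(\<Sum>y\<in>S. scale (u y) y) = 0" "x \<in> S" "u x \<noteq> 0"
    obtain C where C: "C \<subseteq> A" "S = w ` C" using *(2) by (meson subset_imageE)
    have inj: "inj_on w C" using \<open>inj w\<close> by (rule inj_on_subset) simp
    have "finite C" using *(1) C inj finite_imageD by blast
    moreover have "(\<Sum>c\<in>C. scale (u (w c)) (w c)) = 0"
      using *(3) by (simp add: C(2) sum.reindex[OF inj])
    moreover obtain d where "d \<in> C" "x = w d" using *(4) C by auto
    ultimately show False using indep[of C "\<lambda>c. u (w c)" d] *(5) by simp
  qed
  have "\<exists>F. finite F \<and> F \<subseteq> B \<and> x \<in> T.vs1.span F" for x
  proof -
    have "x \<in> T.vs1.span B" using span by simp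
    then obtain S r where "finite S" "S \<subseteq> B" "x = (\<Sum>a\<in>S. scale (r a) a)"
      by (auto simp: T.vs1.span_explicit)
    then show ?thesis by (intro exI[of _ S]) (simp add: T.vs1.span_sum T.vs1.span_scale T.vs1.span_base)
  qed
  then have UN: "(UNIV :: complex set) = (\<Union>F\<in>{F. finite F \<and> F \<subseteq> B}. {c. w c \<in> T.vs1.span F})" by blast
  have cnt: "countable {c. w c \<in> T.vs1.span F}" if "finite F" for F
  proof -
    have "w ` {c. w c \<in> T.vs1.span F} \<subseteq> T.vs1.span F" by auto
    then have "finite (w ` {c. w c \<in> T.vs1.span F})"
      using T.vs1.independent_span_bound[OF that ind] by blast
    then have "finite {c. w c \<in> T.vs1.span F}"
      using inj_on_subset[OF \<open>inj w\<close>] by (rule finite_imageD) simp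
    then show ?thesis by (rule countable_finite)
  qed
  have "countable {F. finite F \<and> F \<subseteq> B}" using \<open>countable B\<close> by (rule countable_Collect_finite_subset)
  then have "countable (UNIV :: complex set)" unfolding UN by (rule countable_UN) (use cnt in simp)
  then have "countable (range complex_of_real)" by (rule countable_subset[rotated]) simp
  then show False
    using uncountable_UNIV_real countable_image_inj_on[of complex_of_real UNIV] by (simp add: inj_of_real)
qed

text \<open>Schur's lemma in Dixmier's form; the space may have infinite dimension.\<close>

lemma schur_countable:
  fixes scale :: "complex \<Rightarrow> 'v::ab_group_add \<Rightarrow> 'v" and A :: "('v \<Rightarrow> 'v) set"
  assumes "countable A" and linA: "\<And>f. f \<in> A \<Longrightarrow> Vector_Spaces.linear scale scale f"
    and nz: "(UNIV :: 'v set) \<noteq> {0}"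
    and irr: "\<And>W. module.subspace scale W \<Longrightarrow> (\<And>f. f \<in> A \<Longrightarrow> f ` W \<subseteq> W) \<Longrightarrow> W = {0} \<or> W = UNIV"
    and lin: "Vector_Spaces.linear scale scale T"
    and comm: "\<And>f. f \<in> A \<Longrightarrow> T \<circ> f = f \<circ> T"
  shows "\<exists>c. T = scale c"
proof -
  interpret T: Vector_Spaces.linear scale scale T by (rule lin)
  have comm': "T (f x) = f (T x)" if "f \<in> A" for f x using comm[OF that] by (metis comp_apply)
  obtain v :: 'v where v: "v \<noteq> 0" using nz by auto
  \<comment> \<open>The orbit of \<open>v\<close> under words in \<open>A\<close> is countable, and its span is invariant.\<close>
  define B where "B = (\<lambda>fs. foldr (\<lambda>f. f) fs v) ` lists A"
  have "countable B" unfolding B_def using \<open>countable A\<close> by (intro countable_image countable_lists)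
  have "T.vs1.span B = UNIV"
  proof -
    have "f ` T.vs1.span B \<subseteq> T.vs1.span B" if f: "f \<in> A" for f
    proof -
      interpret f: Vector_Spaces.linear scale scale f by (rule linA[OF f])
      have "f ` B \<subseteq> B"
      proof
        fix y assume "y \<in> f ` B"
        then obtain fs where "fs \<in> lists A" "y = foldr (\<lambda>f. f) (f # fs) v" by (auto simp: B_def)
        then show "y \<in> B" unfolding B_def using f by (intro image_eqI[of _ _ "f # fs"]) auto
      qed
      then show ?thesis using f.span_image[of B] T.vs1.span_mono by blast
    qed
    moreover have "v \<in> B" unfolding B_def by (rule image_eqI[of _ _ "[]"]) auto
    ultimately show ?thesis using irr[of "T.vs1.span B"] v T.vs1.span_base[of v B] T.vs1.subspace_span[of B] by blast
  qed
  have ev: "\<exists>c u. u \<noteq> 0 \<and> T u = scale c u"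
  proof (rule ccontr)
    assume no_ev: "\<not> ?thesis"
    have "\<exists>x. T x - scale c x = v" for c
    proof -
      let ?R = "range (\<lambda>x. T x - scale c x)"
      have lc: "Vector_Spaces.linear scale scale (\<lambda>x. T x - scale c x)"
        by unfold_locales (simp_all add: T.add T.scale T.vs1.scale_right_distrib
            T.vs1.scale_right_diff_distrib T.vs1.scale_left_commute)
      interpret c: Vector_Spaces.linear scale scale "\<lambda>x. T x - scale c x" by (rule lc)
      have sub: "T.vs1.subspace ?R" using c.subspace_image[of UNIV] T.vs1.subspace_UNIV by simp
      have inv: "f ` ?R \<subseteq> ?R" if "f \<in> A" for f
      proof -
        interpret f: Vector_Spaces.linear scale scale f by (rule linA[OF that])
        have "f (T x - scale c x) = T (f x) - scale c (f x)" for x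
          by (simp add: comm'[OF that] f.diff f.scale)
        then show ?thesis by auto
      qed
      have "T v - scale c v \<noteq> 0" using no_ev v by auto
      then have "?R \<noteq> {0}" by blast
      with irr[OF sub inv] have "v \<in> ?R" by simp
      then show ?thesis by auto
    qed
    then obtain w where "\<And>c. T (w c) - scale c (w c) = v" by metis
    with no_ev show False
      using eigenvector_if_resolvents[OF lin \<open>countable B\<close> \<open>T.vs1.span B = UNIV\<close> v] by blast
  qed
  then obtain c u where u: "u \<noteq> 0" "T u = scale c u" by blast
  let ?K = "{x. T x = scale c x}"
  have subK: "T.vs1.subspace ?K"
    by (rule T.vs1.subspaceI)
      (auto simp: T.zero T.add T.scale T.vs1.scale_right_distrib mult.commute)
  have invK: "f ` ?K \<subseteq> ?K" if "f \<in> A" for f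
  proof -
    interpret f: Vector_Spaces.linear scale scale f by (rule linA[OF that])
    show ?thesis using comm'[OF that] by (auto simp: f.scale)
  qed
  have "?K \<noteq> {0}" using u by blast
  with irr[OF subK invK] have "?K = UNIV" by simp
  then show ?thesis by (intro exI[of _ c]) auto
qed

section \<open>The enveloping group and the inner group\<close>

lemma Inn_apply:
  assumes "a \<in> carrier (Inn Q)" "b \<in> carrier (Inn Q)" "y \<in> carrier Q"
  shows "(a \<otimes>\<^bsub>Inn Q\<^esub> b) y = a (b y)" "a y \<in> carrier Q" "\<one>\<^bsub>Inn Q\<^esub> y = y"
proof -
  have "carrier (Inn Q) \<subseteq> Bij (carrier Q)"
    using group.carrier_subgroup_generated_subset[OF group_BijGroup, of "carrier Q"]
    by (auto simp: Inn_def BijGroup_def)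
  then have ab: "a \<in> Bij (carrier Q)" "b \<in> Bij (carrier Q)" using assms by auto
  then show "(a \<otimes>\<^bsub>Inn Q\<^esub> b) y = a (b y)"
    using assms(3) by (simp add: Inn_def BijGroup_def compose_def)
  show "a y \<in> carrier Q" using ab(1) assms(3) by (auto simp: Bij_def bij_betw_def)
  show "\<one>\<^bsub>Inn Q\<^esub> y = y" using assms(3) by (simp add: Inn_def BijGroup_def)
qed

lemma env_gen_closed: "x \<in> carrier Q \<Longrightarrow> env_gen Q x \<in> carrier (env_group Q)"
  by (auto simp: env_gen_def env_carrier)

lemma inv_env_gen:
  assumes "x \<in> carrier Q"
  shows "inv\<^bsub>env_group Q\<^esub> env_gen Q x = env_rel Q `` {[(x, False)]}"
proof -
  interpret group "env_group Q" by (rule group_env_group)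
  have "env_step Q ([] @ [(x, False), (x, \<not> False)] @ []) ([] @ [])"
    by (rule env_step.cancel) (use assms in auto)
  then have "([(x, False), (x, True)], []) \<in> env_rel Q" using assms by (auto simp: env_rel_def)
  then have "env_rel Q `` {[(x, False)]} \<otimes>\<^bsub>env_group Q\<^esub> env_gen Q x = \<one>\<^bsub>env_group Q\<^esub>"
    using assms equiv_class_eq[OF equiv_env_rel] by (auto simp: env_mult_class env_one env_gen_def)
  moreover have "env_rel Q `` {[(x, False)]} \<in> carrier (env_group Q)"
    using assms by (auto simp: env_carrier)
  ultimately show ?thesis using env_gen_closed[OF assms] by (intro inv_equality)
qed

lemma env_group_induct [consumes 1, case_names one gen inv_gen]:
  assumes "g \<in> carrier (env_group Q)"
    and one: "P \<one>\<^bsub>env_group Q\<^esub>"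
    and gen: "\<And>x g. x \<in> carrier Q \<Longrightarrow> g \<in> carrier (env_group Q) \<Longrightarrow> P g \<Longrightarrow> P (env_gen Q x \<otimes>\<^bsub>env_group Q\<^esub> g)"
    and inv_gen: "\<And>x g. x \<in> carrier Q \<Longrightarrow> g \<in> carrier (env_group Q) \<Longrightarrow> P g
      \<Longrightarrow> P (inv\<^bsub>env_group Q\<^esub> env_gen Q x \<otimes>\<^bsub>env_group Q\<^esub> g)"
  shows "P g"
proof -
  have "P (env_rel Q `` {u})" if "u \<in> env_words Q" for u
    using that
  proof (induction u)
    case Nil
    then show ?case using one by (simp add: env_one)
  next
    case (Cons p u)
    obtain x e where p: "p = (x, e)" by force
    have x: "x \<in> carrier Q" and u: "u \<in> env_words Q" using Cons.prems p by auto
    have "env_rel Q `` {p # u} = env_rel Q `` {[p]} \<otimes>\<^bsub>env_group Q\<^esub> env_rel Q `` {u}"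
      using Cons.prems env_mult_class[of "[p]" Q u] by auto
    moreover have "env_rel Q `` {u} \<in> carrier (env_group Q)" using u by (auto simp: env_carrier)
    ultimately show ?case
      using gen[OF x] inv_gen[OF x] Cons.IH[OF u] p x
      by (cases e) (auto simp: env_gen_def[symmetric] inv_env_gen[symmetric])
  qed
  with assms(1) show ?thesis by (auto simp: env_carrier)
qed

lemma env_lift_hom:
  assumes "quandle Q" "group H" "f \<in> carrier Q \<rightarrow> carrier H"
    and "\<And>x y. x \<in> carrier Q \<Longrightarrow> y \<in> carrier Q \<Longrightarrow> f (x \<triangleright>\<^bsub>Q\<^esub> y) = f x \<otimes>\<^bsub>H\<^esub> f y \<otimes>\<^bsub>H\<^esub> inv\<^bsub>H\<^esub> f x"
  shows "env_lift Q H f \<in> hom (env_group Q) H"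
    and "x \<in> carrier Q \<Longrightarrow> env_lift Q H f (env_gen Q x) = f x"
  using theI'[OF env_lift_ex1[OF assms]] by (auto simp: env_lift_def)

lemma theta_env_hom:
  assumes "quandle Q"
  shows "theta_env Q \<in> hom (env_group Q) (Inn Q)"
    and "x \<in> carrier Q \<Longrightarrow> theta_env Q (env_gen Q x) = left_mult Q x"
  using assms by (intro env_lift_hom; auto intro: group_Inn left_mult_Inn left_mult_rel)+

text \<open>Conjugation by an element \<open>g\<close> of the enveloping group permutes the images of the generators
  through \<open>\<theta>(g)\<close>. In particular only \<open>\<theta>(g)\<close> matters for this action, which is how the centrality of
  the kernel of \<open>\<theta>\<close> enters.\<close>

lemma env_lift_twisted_commute:
  assumes "quandle Q" "group H" "f \<in> carrier Q \<rightarrow> carrier H"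
    and rel: "\<And>x y. x \<in> carrier Q \<Longrightarrow> y \<in> carrier Q \<Longrightarrow> f (x \<triangleright>\<^bsub>Q\<^esub> y) = f x \<otimes>\<^bsub>H\<^esub> f y \<otimes>\<^bsub>H\<^esub> inv\<^bsub>H\<^esub> f x"
    and "g \<in> carrier (env_group Q)" "y \<in> carrier Q"
  shows "env_lift Q H f g \<otimes>\<^bsub>H\<^esub> f y = f (theta_env Q g y) \<otimes>\<^bsub>H\<^esub> env_lift Q H f g"
proof -
  interpret quandle Q by fact
  interpret G: group "env_group Q" by (rule group_env_group)
  interpret I: group "Inn Q" by (rule group_Inn)
  interpret H: group H by fact
  interpret l: group_hom "env_group Q" H "env_lift Q H f"
    using env_lift_hom(1)[OF assms(1-4)] by unfold_locales
  interpret t: group_hom "env_group Q" "Inn Q" "theta_env Q"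
    using theta_env_hom(1)[OF assms(1)] by unfold_locales
  note l_gen = env_lift_hom(2)[OF assms(1-4)] and t_gen = theta_env_hom(2)[OF assms(1)]
  have fcl: "f x \<in> carrier H" if "x \<in> carrier Q" for x using that assms(3) by auto
  have swap: "f x \<otimes>\<^bsub>H\<^esub> f z = f (x \<triangleright>\<^bsub>Q\<^esub> z) \<otimes>\<^bsub>H\<^esub> f x" if "x \<in> carrier Q" "z \<in> carrier Q" for x z
    using that fcl by (simp add: rel H.m_assoc)
  from assms(5) show ?thesis
  proof (induction rule: env_group_induct)
    case one
    then show ?case using fcl[OF assms(6)] assms(6)
      by (simp add: Inn_apply(3)[OF I.one_closed I.one_closed])
  next
    case (gen x g)
    have x: "env_gen Q x \<in> carrier (env_group Q)" using gen by (simp add: env_gen_closed)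
    let ?z = "theta_env Q g y"
    have z: "?z \<in> carrier Q"
      using Inn_apply(2)[OF t.hom_closed t.hom_closed assms(6)] gen(2) by blast
    have th: "theta_env Q (env_gen Q x \<otimes>\<^bsub>env_group Q\<^esub> g) y = x \<triangleright>\<^bsub>Q\<^esub> ?z"
      using gen x z Inn_apply(1)[OF t.hom_closed[OF x] t.hom_closed[OF gen(2)] assms(6)]
      by (simp add: t_gen left_mult_def)
    have fx: "f x \<in> carrier H" and fy: "f y \<in> carrier H" and fz: "f ?z \<in> carrier H"
      and fxz: "f (x \<triangleright>\<^bsub>Q\<^esub> ?z) \<in> carrier H" and lg: "env_lift Q H f g \<in> carrier H"
      using gen(1,2) z assms(6) by (simp_all add: fcl tri_closed)
    have "f x \<otimes>\<^bsub>H\<^esub> env_lift Q H f g \<otimes>\<^bsub>H\<^esub> f y = f x \<otimes>\<^bsub>H\<^esub> f ?z \<otimes>\<^bsub>H\<^esub> env_lift Q H f g"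
      using gen(3) fx fy fz lg by (simp add: H.m_assoc)
    also have "f x \<otimes>\<^bsub>H\<^esub> f ?z = f (x \<triangleright>\<^bsub>Q\<^esub> ?z) \<otimes>\<^bsub>H\<^esub> f x"
      by (rule swap[OF gen(1) z])
    also have "\<dots> \<otimes>\<^bsub>H\<^esub> env_lift Q H f g = f (x \<triangleright>\<^bsub>Q\<^esub> ?z) \<otimes>\<^bsub>H\<^esub> (f x \<otimes>\<^bsub>H\<^esub> env_lift Q H f g)"
      by (rule H.m_assoc[OF fxz fx lg])
    finally show ?case unfolding th using x by (simp add: l_gen gen(1,2))
  next
    case (inv_gen x g)
    have x: "env_gen Q x \<in> carrier (env_group Q)" using inv_gen by (simp add: env_gen_closed)
    let ?z = "theta_env Q g y" and ?w = "theta_env Q (inv\<^bsub>env_group Q\<^esub> env_gen Q x \<otimes>\<^bsub>env_group Q\<^esub> g) y"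
    have t: "theta_env Q k y \<in> carrier Q" if "k \<in> carrier (env_group Q)" for k
      using Inn_apply(2)[OF t.hom_closed t.hom_closed assms(6)] that by blast
    have k: "inv\<^bsub>env_group Q\<^esub> env_gen Q x \<otimes>\<^bsub>env_group Q\<^esub> g \<in> carrier (env_group Q)"
      using x inv_gen(2) by simp
    have z: "?z \<in> carrier Q" and w: "?w \<in> carrier Q" by (rule t[OF inv_gen(2)], rule t[OF k])
    \<comment> \<open>The point \<open>?w\<close> is \<open>L\<^sub>x\<^sup>-\<^sup>1 ?z\<close>: apply \<open>\<theta>\<close> to the product of the generator with its inverse and \<open>g\<close>.\<close>
    have "theta_env Q (env_gen Q x \<otimes>\<^bsub>env_group Q\<^esub> (inv\<^bsub>env_group Q\<^esub> env_gen Q x \<otimes>\<^bsub>env_group Q\<^esub> g)) y = x \<triangleright>\<^bsub>Q\<^esub> ?w"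
      using w inv_gen(1) Inn_apply(1)[OF t.hom_closed[OF x] t.hom_closed[OF k] assms(6)]
      by (subst t.hom_mult[OF x k]) (simp add: t_gen left_mult_def)
    then have xw: "x \<triangleright>\<^bsub>Q\<^esub> ?w = ?z" using x inv_gen(2) by (simp add: G.m_assoc[symmetric])
    have lw: "env_lift Q H f (inv\<^bsub>env_group Q\<^esub> env_gen Q x \<otimes>\<^bsub>env_group Q\<^esub> g) = inv\<^bsub>H\<^esub> f x \<otimes>\<^bsub>H\<^esub> env_lift Q H f g"
      using x inv_gen by (simp add: l_gen)
    have fx: "f x \<in> carrier H" and fy: "f y \<in> carrier H" and fz: "f ?z \<in> carrier H"
      and fw: "f ?w \<in> carrier H" and lg: "env_lift Q H f g \<in> carrier H"
      using inv_gen(1,2) z w assms(6) by (simp_all only: fcl l.hom_closed)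
    have "inv\<^bsub>H\<^esub> f x \<otimes>\<^bsub>H\<^esub> env_lift Q H f g \<otimes>\<^bsub>H\<^esub> f y = inv\<^bsub>H\<^esub> f x \<otimes>\<^bsub>H\<^esub> f ?z \<otimes>\<^bsub>H\<^esub> env_lift Q H f g"
      using inv_gen(3) fx fy fz lg by (simp add: H.m_assoc)
    also have "inv\<^bsub>H\<^esub> f x \<otimes>\<^bsub>H\<^esub> f ?z = f ?w \<otimes>\<^bsub>H\<^esub> inv\<^bsub>H\<^esub> f x"
    proof -
      have "f ?z = f x \<otimes>\<^bsub>H\<^esub> (f ?w \<otimes>\<^bsub>H\<^esub> inv\<^bsub>H\<^esub> f x)"
        using rel[OF inv_gen(1) w] fx fw unfolding xw by (simp only: H.m_assoc H.inv_closed)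
      then show ?thesis using fx fw fz by (metis H.inv_solve_left H.inv_closed H.m_closed)
    qed
    also have "\<dots> \<otimes>\<^bsub>H\<^esub> env_lift Q H f g = f ?w \<otimes>\<^bsub>H\<^esub> (inv\<^bsub>H\<^esub> f x \<otimes>\<^bsub>H\<^esub> env_lift Q H f g)"
      by (rule H.m_assoc[OF fw H.inv_closed[OF fx] lg])
    finally show ?case unfolding lw .
  qed
qed

section \<open>Quandle representations and projective classes\<close>

lemma GL_simps: "f \<otimes>\<^bsub>GL scale\<^esub> g = f \<circ> g" "\<one>\<^bsub>GL scale\<^esub> = id"
  "f \<in> carrier (GL scale) \<longleftrightarrow> Vector_Spaces.linear scale scale f \<and> bij f"
  by (simp_all add: GL_def)

lemma proj_class_eq_iff:
  assumes "vector_space scale"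
  shows "proj_class scale f = proj_class scale g \<longleftrightarrow> (\<exists>c. c \<noteq> 0 \<and> f = (\<lambda>v. scale c (g v)))"
proof -
  interpret vector_space scale by fact
  have pc: "proj_class scale h = {\<lambda>v. scale c (h v) | c. c \<noteq> 0}" for h
    by (auto simp: proj_class_def r_coset_def homotheties_def GL_simps comp_def)
  show ?thesis
  proof
    assume "proj_class scale f = proj_class scale g"
    moreover have "f \<in> proj_class scale f" unfolding pc by (auto intro!: exI[of _ 1])
    ultimately show "\<exists>c. c \<noteq> 0 \<and> f = (\<lambda>v. scale c (g v))" by (auto simp: pc)
  next
    assume "\<exists>c. c \<noteq> 0 \<and> f = (\<lambda>v. scale c (g v))"
    then obtain c where c: "c \<noteq> 0" "f = (\<lambda>v. scale c (g v))" by blast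
    have "\<exists>d. d \<noteq> 0 \<and> (\<lambda>v. scale b (g v)) = (\<lambda>v. scale d (f v))" if "b \<noteq> 0" for b
      using that c by (intro exI[of _ "b / c"]) auto
    moreover have "\<exists>d. d \<noteq> 0 \<and> (\<lambda>v. scale b (f v)) = (\<lambda>v. scale d (g v))" if "b \<noteq> 0" for b
      using that c by (intro exI[of _ "b * c"]) auto
    ultimately show "proj_class scale f = proj_class scale g" unfolding pc by blast
  qed
qed

lemma quandle_rep_swap:
  assumes "vector_space scale" "quandle_rep Q scale \<rho>" "x \<in> carrier Q" "y \<in> carrier Q"
  shows "\<rho> (x \<triangleright>\<^bsub>Q\<^esub> y) \<circ> \<rho> x = \<rho> x \<circ> \<rho> y"
proof -
  interpret G: group "GL scale" by (rule group_GL) fact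
  have "\<rho> x \<in> carrier (GL scale)" "\<rho> y \<in> carrier (GL scale)"
    using assms(2-4) by (auto simp: quandle_rep_def)
  then have "\<rho> (x \<triangleright>\<^bsub>Q\<^esub> y) \<otimes>\<^bsub>GL scale\<^esub> \<rho> x = \<rho> x \<otimes>\<^bsub>GL scale\<^esub> \<rho> y"
    using assms(2-4) by (simp add: quandle_rep_def G.m_assoc)
  then show ?thesis by (simp add: GL_simps)
qed

text \<open>The projective representation satisfies \<open>\<rho>\<^sub>I\<^sub>n\<^sub>n(L\<^sub>x) = [\<rho>(x)]\<close>, whatever preimage of \<open>L\<^sub>x\<close> the chosen
  section picks. Countability of \<open>Q\<close> is what Schur's lemma requires.\<close>

lemma rep_Inn_left_mult:
  fixes scale :: "complex \<Rightarrow> 'v::ab_group_add \<Rightarrow> 'v"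
  assumes "quandle Q" and cnt: "countable (carrier Q)" and "vector_space scale"
    and irr: "irreducible_quandle_rep Q scale \<rho>" and x: "x \<in> carrier Q"
  shows "rep_Inn Q scale \<rho> (left_mult Q x) = proj_class scale (\<rho> x)"
proof -
  interpret quandle Q by fact
  interpret G: group "GL scale" by (rule group_GL) fact
  interpret I: group "Inn Q" by (rule group_Inn)
  have rep: "quandle_rep Q scale \<rho>" using irr by (simp add: irreducible_quandle_rep_def)
  then have cl: "\<rho> \<in> carrier Q \<rightarrow> carrier (GL scale)" by (simp add: quandle_rep_def)
  have rel: "\<rho> (a \<triangleright>\<^bsub>Q\<^esub> b) = \<rho> a \<otimes>\<^bsub>GL scale\<^esub> \<rho> b \<otimes>\<^bsub>GL scale\<^esub> inv\<^bsub>GL scale\<^esub> \<rho> a"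
    if "a \<in> carrier Q" "b \<in> carrier Q" for a b using rep that by (simp add: quandle_rep_def)
  note GLg = G.is_group
  define s where "s = inv_into (carrier (env_group Q)) (theta_env Q) (left_mult Q x)"
  have im: "left_mult Q x \<in> theta_env Q ` carrier (env_group Q)"
    using theta_env_hom(2)[OF assms(1) x] env_gen_closed[OF x] by (metis imageI)
  have s: "s \<in> carrier (env_group Q)" and ts: "theta_env Q s = left_mult Q x"
    unfolding s_def using im by (auto intro: inv_into_into f_inv_into_f)
  define R where "R = rep_env Q scale \<rho> s"
  have R: "R \<in> carrier (GL scale)"
    unfolding R_def using env_lift_hom(1)[OF assms(1) GLg cl rel] s by (auto simp: hom_def)
  define T where "T = inv\<^bsub>GL scale\<^esub> R \<otimes>\<^bsub>GL scale\<^esub> \<rho> x"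
  have rx: "\<rho> x \<in> carrier (GL scale)" using cl x by auto
  have T: "T \<in> carrier (GL scale)" using R rx by (simp add: T_def)
  have comm: "T \<circ> \<rho> y = \<rho> y \<circ> T" if y: "y \<in> carrier Q" for y
  proof -
    have ry: "\<rho> y \<in> carrier (GL scale)" and rxy: "\<rho> (x \<triangleright>\<^bsub>Q\<^esub> y) \<in> carrier (GL scale)"
      using cl x y tri_closed[OF x y] by auto
    have Ry: "R \<otimes>\<^bsub>GL scale\<^esub> \<rho> y = \<rho> (x \<triangleright>\<^bsub>Q\<^esub> y) \<otimes>\<^bsub>GL scale\<^esub> R"
      using env_lift_twisted_commute[OF assms(1) GLg cl rel s y] y ts by (simp add: R_def left_mult_def)
    have xy: "\<rho> x \<otimes>\<^bsub>GL scale\<^esub> \<rho> y = \<rho> (x \<triangleright>\<^bsub>Q\<^esub> y) \<otimes>\<^bsub>GL scale\<^esub> \<rho> x"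
      using quandle_rep_swap[OF assms(3) rep x y] by (simp add: GL_simps)
    have "R \<otimes>\<^bsub>GL scale\<^esub> (\<rho> y \<otimes>\<^bsub>GL scale\<^esub> T) = \<rho> (x \<triangleright>\<^bsub>Q\<^esub> y) \<otimes>\<^bsub>GL scale\<^esub> (R \<otimes>\<^bsub>GL scale\<^esub> T)"
      using R T ry rxy by (simp add: Ry G.m_assoc[symmetric])
    also have "R \<otimes>\<^bsub>GL scale\<^esub> T = \<rho> x" using R rx by (simp add: T_def G.m_assoc[symmetric])
    also have "\<rho> (x \<triangleright>\<^bsub>Q\<^esub> y) \<otimes>\<^bsub>GL scale\<^esub> \<rho> x = R \<otimes>\<^bsub>GL scale\<^esub> (T \<otimes>\<^bsub>GL scale\<^esub> \<rho> y)"
      using R rx ry by (simp add: xy T_def G.m_assoc[symmetric])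
    finally have "\<rho> y \<otimes>\<^bsub>GL scale\<^esub> T = T \<otimes>\<^bsub>GL scale\<^esub> \<rho> y" using R T ry by simp
    then show ?thesis by (simp add: GL_simps)
  qed
  have "\<exists>c. T = scale c"
  proof (rule schur_countable)
    show "countable (\<rho> ` carrier Q)" using cnt by (rule countable_image)
    show "Vector_Spaces.linear scale scale f" if "f \<in> \<rho> ` carrier Q" for f
      using that cl by (auto simp: GL_simps)
    show "(UNIV :: 'v set) \<noteq> {0}" using irr by (simp add: irreducible_quandle_rep_def)
    show "W = {0} \<or> W = UNIV"
      if "module.subspace scale W" "\<And>f. f \<in> \<rho> ` carrier Q \<Longrightarrow> f ` W \<subseteq> W" for W
      using irr that unfolding irreducible_quandle_rep_def by blast
    show "Vector_Spaces.linear scale scale T" using T by (simp add: GL_simps)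
    show "T \<circ> f = f \<circ> T" if "f \<in> \<rho> ` carrier Q" for f using that comm by auto
  qed
  then obtain c where c: "T = scale c" by blast
  interpret vector_space scale by fact
  have "c \<noteq> 0"
  proof
    assume "c = 0"
    then have "T u = 0" for u using c by simp
    then have "u = 0" for u :: 'v using T unfolding GL_simps by (metis bij_pointE)
    then show False using irr by (auto simp: irreducible_quandle_rep_def)
  qed
  moreover have "\<rho> x = (\<lambda>v. scale c (R v))"
  proof -
    interpret R: Vector_Spaces.linear scale scale R using R by (simp add: GL_simps)
    have "\<rho> x = R \<otimes>\<^bsub>GL scale\<^esub> T" using R rx by (simp add: T_def G.m_assoc[symmetric])
    then show ?thesis by (auto simp: GL_simps c R.scale)
  qed
  ultimately have "proj_class scale (\<rho> x) = proj_class scale R"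
    using proj_class_eq_iff[OF assms(3)] by blast
  then show ?thesis
    using left_mult_Inn[OF assms(1) x] by (simp add: rep_Inn_def R_def s_def)
qed

text \<open>The irreducibility of the representations plays no role here; \<open>V \<noteq> 0\<close> makes the scalars
  \<open>\<chi> x\<close> unique.\<close>

lemma quandle_rep_proportional:
  fixes scale :: "complex \<Rightarrow> 'v::ab_group_add \<Rightarrow> 'v"
  assumes "quandle Q" "vector_space scale" "quandle_rep Q scale \<rho>" "quandle_rep Q scale \<rho>'"
    and nz: "(UNIV :: 'v set) \<noteq> {0}"
    and proj_eq: "\<And>x. x \<in> carrier Q \<Longrightarrow> proj_class scale (\<rho>' x) = proj_class scale (\<rho> x)"
  shows "\<exists>\<chi>. quandle_character Q \<chi> \<and> (\<forall>x\<in>carrier Q. \<rho>' x = char_twist scale \<chi> \<rho> x)"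
proof -
  interpret quandle Q by fact
  interpret vector_space scale by fact
  have "\<forall>x\<in>carrier Q. \<exists>c. c \<noteq> 0 \<and> \<rho>' x = (\<lambda>v. scale c (\<rho> x v))"
    using proj_eq proj_class_eq_iff[OF assms(2)] by blast
  then obtain \<chi> where \<chi>: "\<And>x. x \<in> carrier Q \<Longrightarrow> \<chi> x \<noteq> 0"
    "\<And>x v. x \<in> carrier Q \<Longrightarrow> \<rho>' x v = scale (\<chi> x) (\<rho> x v)" by (metis (no_types, lifting))
  have "\<chi> (x \<triangleright>\<^bsub>Q\<^esub> y) = \<chi> y" if x: "x \<in> carrier Q" and y: "y \<in> carrier Q" for x y
  proof -
    have GL: "Vector_Spaces.linear scale scale (\<rho> z)" "bij (\<rho> z)" if "z \<in> carrier Q" for z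
      using assms(3) that by (auto simp: quandle_rep_def GL_simps)
    interpret x: Vector_Spaces.linear scale scale "\<rho> x" by (rule GL(1)[OF x])
    interpret xy: Vector_Spaces.linear scale scale "\<rho> (x \<triangleright>\<^bsub>Q\<^esub> y)" by (rule GL(1)[OF tri_closed[OF x y]])
    have "bij (\<rho> x \<circ> \<rho> y)" using GL x y by (intro bij_comp) auto
    moreover obtain w :: 'v where "w \<noteq> 0" using nz by auto
    ultimately obtain v where v: "\<rho> x (\<rho> y v) \<noteq> 0" by (metis bij_pointE comp_apply)
    have "\<rho> (x \<triangleright>\<^bsub>Q\<^esub> y) (\<rho> x v) = \<rho> x (\<rho> y v)"
      using quandle_rep_swap[OF assms(2,3) x y] by (metis comp_apply)
    moreover have "\<rho>' (x \<triangleright>\<^bsub>Q\<^esub> y) (\<rho>' x v) = \<rho>' x (\<rho>' y v)"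
      using quandle_rep_swap[OF assms(2,4) x y] by (metis comp_apply)
    ultimately have "scale (\<chi> (x \<triangleright>\<^bsub>Q\<^esub> y) * \<chi> x) (\<rho> x (\<rho> y v)) = scale (\<chi> x * \<chi> y) (\<rho> x (\<rho> y v))"
      using x y tri_closed[OF x y] by (simp add: \<chi>(2) x.scale xy.scale)
    then show ?thesis using v \<chi>(1)[OF x] by simp
  qed
  then show ?thesis
    using \<chi> by (intro exI[of _ \<chi>]) (auto simp: quandle_character_def char_twist_def)
qed

theorem proposition2p9:
  fixes Q :: "('a, 'm) quandle_struct_scheme"
    and scale :: "complex \<Rightarrow> 'v::ab_group_add \<Rightarrow> 'v"
    and \<rho> :: "'a \<Rightarrow> 'v \<Rightarrow> 'v"
  assumes "quandle Q" and "finite (carrier Q)"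
    and "vector_space scale"
    and "irreducible_quandle_rep Q scale \<rho>"
  shows "(\<forall>\<rho>'. irreducible_quandle_rep Q scale \<rho>' \<and> rep_Inn Q scale \<rho>' = rep_Inn Q scale \<rho> \<longrightarrow>
            (\<exists>\<chi>. quandle_character Q \<chi> \<and> (\<forall>x\<in>carrier Q. \<rho>' x = char_twist scale \<chi> \<rho> x))) \<and>
         (\<forall>\<sigma>. lifts_rep_Inn Q scale \<rho> \<sigma> \<longrightarrow>
            irreducible_quandle_rep Q scale (\<sigma> \<circ> left_mult Q) \<and>
            (\<exists>\<chi>. quandle_character Q \<chi> \<and>
              (\<forall>x\<in>carrier Q. \<rho> x = char_twist scale \<chi> (\<sigma> \<circ> left_mult Q) x)))"
proof -
  note Inn_eq = rep_Inn_left_mult[OF assms(1) countable_finite[OF assms(2)] assms(3)]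
  have rep: "quandle_rep Q scale \<rho>" and nz: "(UNIV :: 'v set) \<noteq> {0}"
    using assms(4) by (simp_all add: irreducible_quandle_rep_def)
  have part1: "\<exists>\<chi>. quandle_character Q \<chi> \<and> (\<forall>x\<in>carrier Q. \<rho>' x = char_twist scale \<chi> \<rho> x)"
    if irr': "irreducible_quandle_rep Q scale \<rho>'"
      and eq: "rep_Inn Q scale \<rho>' = rep_Inn Q scale \<rho>" for \<rho>'
  proof (rule quandle_rep_proportional[OF assms(1,3) rep _ nz])
    show "quandle_rep Q scale \<rho>'" using irr' by (simp add: irreducible_quandle_rep_def)
    show "proj_class scale (\<rho>' x) = proj_class scale (\<rho> x)" if "x \<in> carrier Q" for x
      using Inn_eq[OF irr' that] Inn_eq[OF assms(4) that] eq by simp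
  qed
  have part2: "irreducible_quandle_rep Q scale (\<sigma> \<circ> left_mult Q)
      \<and> (\<exists>\<chi>. quandle_character Q \<chi> \<and> (\<forall>x\<in>carrier Q. \<rho> x = char_twist scale \<chi> (\<sigma> \<circ> left_mult Q) x))"
    if lift: "lifts_rep_Inn Q scale \<rho> \<sigma>" for \<sigma>
  proof -
    interpret vector_space scale by fact
    interpret s: group_hom "Inn Q" "GL scale" \<sigma>
      using lift by (simp add: group_hom_def group_hom_axioms_def lifts_rep_Inn_def
          group_Inn group_GL[OF assms(3)])
    note L = left_mult_Inn[OF assms(1)]
    have rep\<sigma>: "quandle_rep Q scale (\<sigma> \<circ> left_mult Q)"
      using L by (auto simp: quandle_rep_def left_mult_rel[OF assms(1)])
    have proj_eq: "proj_class scale (\<rho> x) = proj_class scale ((\<sigma> \<circ> left_mult Q) x)"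
      if "x \<in> carrier Q" for x
      using lift Inn_eq[OF assms(4) that] L[OF that] by (simp add: lifts_rep_Inn_def)
    \<comment> \<open>Irreducibility passes to \<open>\<sigma> \<circ> L\<close> since a subspace invariant under \<open>\<sigma>(L\<^sub>x)\<close> is invariant under its
      multiple \<open>\<rho>(x)\<close>.\<close>
    have "\<rho> x ` W \<subseteq> W"
      if "subspace W" "x \<in> carrier Q" "(\<sigma> \<circ> left_mult Q) x ` W \<subseteq> W" for x W
    proof -
      obtain c where "\<rho> x = (\<lambda>v. scale c ((\<sigma> \<circ> left_mult Q) x v))"
        using proj_eq[OF \<open>x \<in> carrier Q\<close>] proj_class_eq_iff[OF assms(3)] by blast
      then show ?thesis using that subspace_scale by auto
    qed
    then have "irreducible_quandle_rep Q scale (\<sigma> \<circ> left_mult Q)"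
      using assms(4) rep\<sigma> unfolding irreducible_quandle_rep_def by blast
    then show ?thesis
      using quandle_rep_proportional[OF assms(1,3) rep\<sigma> rep nz proj_eq] by blast
  qed
  show ?thesis using part1 part2 by blast
qed

end
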